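(* Let $V$ be a finite-dimensional vector space over a field of characteristic different from $2$ and $b$ a non-degenerate symmetric or alternating bilinear form on $V$. Let $\mathcal{V}$ be a linear subspace of $\mathcal{A}_b$ all of whose elements are nilpotent. Let $x\in V\setminus\{0\}$, $u\in\mathcal{V}$ and $y\in V$ be such that $x\wedge_b y\in\mathcal{V}$. Then $b(u(x),y)=0$.
   Context: An endomorphism $u$ is $b$-alternating if $(x,y)\mapsto b(x,u(y))$ is alternating (vanishes on all $(x,x)$); $\mathcal{A}_b$ is the space of these. For $x,y\in V$, $x\wedge_b y$ is the endomorphism $z\mapsto b(y,z)\,x-b(x,z)\,y$. *)

theory Defs
  imports "HOL-Analysis.Analysis"
begin

text \<open>Finite-dimensional vector spaces over a field 'k are modelled as 'k^'n.\<close>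

definition bilinear_form :: "('k::field^'n \<Rightarrow> 'k^'n \<Rightarrow> 'k) \<Rightarrow> bool" where
  "bilinear_form b \<longleftrightarrow>
     (\<forall>y. Vector_Spaces.linear (*s) (*) (\<lambda>x. b x y)) \<and>
     (\<forall>x. Vector_Spaces.linear (*s) (*) (\<lambda>y. b x y))"

definition symmetric_form :: "('k::field^'n \<Rightarrow> 'k^'n \<Rightarrow> 'k) \<Rightarrow> bool" where
  "symmetric_form b \<longleftrightarrow> (\<forall>x y. b x y = b y x)"

definition alternating_form :: "('k::field^'n \<Rightarrow> 'k^'n \<Rightarrow> 'k) \<Rightarrow> bool" where
  "alternating_form b \<longleftrightarrow> (\<forall>x. b x x = 0)"

definition nondegenerate_form :: "('k::field^'n \<Rightarrow> 'k^'n \<Rightarrow> 'k) \<Rightarrow> bool" where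
  "nondegenerate_form b \<longleftrightarrow> (\<forall>x. (\<forall>y. b x y = 0) \<longrightarrow> x = 0)"

text \<open>u is b-alternating: u is an endomorphism and (x,y) |-> b x (u y) is alternating.\<close>
definition b_alternating :: "('k::field^'n \<Rightarrow> 'k^'n \<Rightarrow> 'k) \<Rightarrow> ('k^'n \<Rightarrow> 'k^'n) \<Rightarrow> bool" where
  "b_alternating b u \<longleftrightarrow> Vector_Spaces.linear (*s) (*s) u \<and> (\<forall>x. b x (u x) = 0)"

definition A_b :: "('k::field^'n \<Rightarrow> 'k^'n \<Rightarrow> 'k) \<Rightarrow> ('k^'n \<Rightarrow> 'k^'n) set" where
  "A_b b = {u. b_alternating b u}"

definition wedge_b :: "('k::field^'n \<Rightarrow> 'k^'n \<Rightarrow> 'k) \<Rightarrow> 'k^'n \<Rightarrow> 'k^'n \<Rightarrow> ('k^'n \<Rightarrow> 'k^'n)" where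
  "wedge_b b x y = (\<lambda>z. b y z *s x - b x z *s y)"

text \<open>Linear subspace of the space of endomorphisms (pointwise operations).\<close>
definition endo_subspace :: "('k::field^'n \<Rightarrow> 'k^'n) set \<Rightarrow> bool" where
  "endo_subspace S \<longleftrightarrow> (\<lambda>_. 0) \<in> S \<and>
     (\<forall>u\<in>S. \<forall>v\<in>S. (\<lambda>z. u z + v z) \<in> S) \<and>
     (\<forall>c. \<forall>u\<in>S. (\<lambda>z. c *s u z) \<in> S)"

definition nilpotent_endo :: "('k::field^'n \<Rightarrow> 'k^'n) \<Rightarrow> bool" where
  "nilpotent_endo u \<longleftrightarrow> (\<exists>m. u ^^ m = (\<lambda>_. 0))"

end

theory Submission
  imports Defs "HOL-Computational_Algebra.Polynomial"
begin

text \<open>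
  The trace form (u, v) \<mapsto> tr(u v) vanishes on any linear space of nilpotent endomorphisms:
  polarize tr(v^2) = 0 and use that 2 is invertible. For v = x \<and>_b y the trace of u v is
  b(y, u x) - b(x, u y), and since u is b-alternating this equals 2 b(y, u x). Hence
  b(y, u x) = 0, and b(u x, y) = \<plusminus> b(y, u x) because b is symmetric or alternating.
  That nilpotent matrices have trace zero is read off the linear coefficient of the
  polynomial det(I - X A), which is a unit since I - X A is inverted by \<Sum>_k X^k A^k.
\<close>

lemma coeff_1_mult:
  fixes p q :: "'a::comm_semiring_1 poly"
  shows "coeff (p * q) 1 = coeff p 0 * coeff q 1 + coeff p 1 * coeff q 0"
  by (simp add: coeff_mult atMost_Suc add.commute)

lemma coeff_1_prod_permutes_non_id:
  fixes g :: "'n::finite \<Rightarrow> 'n \<Rightarrow> 'k::comm_semiring_1 poly"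
  assumes off_diag: "\<And>i j. i \<noteq> j \<Longrightarrow> coeff (g i j) 0 = 0"
    and p: "p permutes UNIV" "p \<noteq> id"
  shows "coeff (\<Prod>i\<in>UNIV. g i (p i)) 1 = 0"
proof -
  obtain i where i: "p i \<noteq> i" using p(2) by (auto simp: fun_eq_iff)
  then have pi: "p (p i) \<noteq> p i" using p(1) by (metis permutes_inj injD)
  have "(\<Prod>k\<in>UNIV. g k (p k)) = g i (p i) * (\<Prod>k\<in>UNIV-{i}. g k (p k))"
    by (simp add: prod.remove)
  also have "(\<Prod>k\<in>UNIV-{i}. g k (p k)) = g (p i) (p (p i)) * (\<Prod>k\<in>UNIV-{i}-{p i}. g k (p k))"
    using i by (subst prod.remove[of _ "p i"]) auto
  finally have split: "(\<Prod>k\<in>UNIV. g k (p k))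
      = (g i (p i) * g (p i) (p (p i))) * (\<Prod>k\<in>UNIV-{i}-{p i}. g k (p k))"
    by (simp add: mult.assoc)
  show ?thesis
    unfolding split coeff_1_mult coeff_mult_0
    using off_diag[OF i[symmetric]] off_diag[OF pi[symmetric]] by simp
qed

lemma coeff_prod_linear_factors:
  fixes c :: "'a \<Rightarrow> 'k::comm_ring_1"
  assumes "finite F"
  shows "coeff (\<Prod>i\<in>F. [:1, c i:]) 0 = 1 \<and> coeff (\<Prod>i\<in>F. [:1, c i:]) 1 = sum c F"
  using assms by (induction F rule: finite_induct) (simp_all add: coeff_1_mult coeff_mult_0)

definition one_minus_X_mat :: "'k::comm_ring_1^'n^'n \<Rightarrow> 'k poly^'n^'n" where
  "one_minus_X_mat A = (\<chi> i j. [:(if i = j then 1 else 0), - A$i$j:])"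

lemma coeff_1_det_one_minus_X_mat:
  fixes A :: "'k::comm_ring_1^'n^'n"
  shows "coeff (det (one_minus_X_mat A)) 1 = - trace A"
proof -
  let ?P = "one_minus_X_mat A"
  have "coeff (det ?P) 1 = (\<Sum>p\<in>{p. p permutes UNIV}. of_int (sign p) * coeff (\<Prod>i\<in>UNIV. ?P$i$p i) 1)"
    by (simp add: det_def coeff_sum of_int_poly)
  also have "\<dots> = coeff (\<Prod>i\<in>UNIV. ?P$i$i) 1"
  proof -
    have "(\<Sum>p\<in>{p. p permutes UNIV} - {id}. of_int (sign p) * coeff (\<Prod>i\<in>UNIV. ?P$i$p i) 1) = (0::'k)"
      using coeff_1_prod_permutes_non_id[of "\<lambda>i j. ?P$i$j"]
      by (intro sum.neutral) (auto simp: one_minus_X_mat_def)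
    moreover have "id \<in> {p. p permutes (UNIV :: 'n set)}" by (simp add: permutes_id)
    ultimately show ?thesis
      by (simp add: sum.remove[OF finite_permutations[OF finite_class.finite_UNIV] \<open>id \<in> _\<close>] sign_id)
  qed
  also have "\<dots> = - trace A"
    using coeff_prod_linear_factors[of UNIV "\<lambda>i. - A$i$i"]
    by (simp add: one_minus_X_mat_def trace_def sum_negf)
  finally show ?thesis .
qed

lemma is_unit_det_one_minus_X_mat:
  fixes A :: "'k::field^'n^'n"
  assumes nilpotent: "((**) A ^^ m) (mat 1) = 0"
  shows "is_unit (det (one_minus_X_mat A))"
proof -
  define F where "F k = ((**) A ^^ k) (mat 1)" for k
  define Q :: "'k poly^'n^'n" where "Q = (\<chi> i j. \<Sum>k<m. monom (F k $ i $ j) k)"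
  have "(one_minus_X_mat A ** Q) $ i $ j = (mat 1 :: 'k poly^'n^'n) $ i $ j" for i j
  proof -
    have entry: "one_minus_X_mat A $ i $ l = (if i = l then 1 else 0) - monom (A$i$l) 1" for l
      by (simp add: one_minus_X_mat_def monom_altdef one_pCons)
    have "(\<Sum>l\<in>UNIV. monom (A$i$l) 1 * Q $ l $ j) = (\<Sum>k<m. \<Sum>l\<in>UNIV. monom (A$i$l * F k $ l $ j) (Suc k))"
      by (simp add: Q_def sum_distrib_left mult_monom sum.swap[of _ UNIV])
    also have "\<dots> = (\<Sum>k<m. monom (F (Suc k) $ i $ j) (Suc k))"
      by (simp add: F_def matrix_matrix_mult_def monom_sum)
    finally have shifted: "(\<Sum>l\<in>UNIV. monom (A$i$l) 1 * Q $ l $ j) = (\<Sum>k<m. monom (F (Suc k) $ i $ j) (Suc k))" .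
    have "(one_minus_X_mat A ** Q) $ i $ j = Q $ i $ j - (\<Sum>l\<in>UNIV. monom (A$i$l) 1 * Q $ l $ j)"
      by (simp add: matrix_matrix_mult_def entry left_diff_distrib sum_subtractf
          if_distrib[of "\<lambda>c. c * Q $ _ $ j"] cong: if_cong)
    also have "\<dots> = monom (F 0 $ i $ j) 0 - monom (F m $ i $ j) m"
      using sum_lessThan_telescope'[of "\<lambda>k. monom (F k $ i $ j) k" m]
      by (subst shifted) (simp add: Q_def sum_subtractf)
    also have "\<dots> = (mat 1 :: 'k poly^'n^'n) $ i $ j"
      using nilpotent by (simp add: F_def mat_def)
    finally show ?thesis .
  qed
  then have "one_minus_X_mat A ** Q = mat 1" by (simp add: vec_eq_iff)
  then have "det (one_minus_X_mat A) * det Q = 1" by (metis det_mul det_I)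
  then show ?thesis by (metis dvdI)
qed

lemma trace_nilpotent_matrix:
  fixes A :: "'k::field^'n^'n"
  assumes "((**) A ^^ m) (mat 1) = 0"
  shows "trace A = 0"
proof -
  obtain c where "det (one_minus_X_mat A) = [:c:]"
    using is_unit_det_one_minus_X_mat[OF assms] by (auto simp: is_unit_poly_iff)
  then show ?thesis using coeff_1_det_one_minus_X_mat[of A] by simp
qed

lemma linear_funpow:
  assumes "Vector_Spaces.linear (*s) (*s) (f :: 'k::field^'n \<Rightarrow> 'k^'n)"
  shows "Vector_Spaces.linear (*s) (*s) (f^^k)"
  by (induction k)
    (simp_all add: vec.linear_id[unfolded id_def] Vector_Spaces.linear_compose[OF _ assms, unfolded comp_def])

lemma matrix_funpow:
  fixes f :: "'k::field^'n \<Rightarrow> 'k^'n"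
  assumes "Vector_Spaces.linear (*s) (*s) f"
  shows "matrix (f^^k) = ((**) (matrix f) ^^ k) (mat 1)"
proof (induction k)
  case 0
  show ?case by (simp add: matrix_id_mat_1 flip: id_def)
next
  case (Suc k)
  then show ?case
    using matrix_compose_gen[OF linear_funpow[OF assms, of k] assms] by (simp add: comp_def)
qed

lemma trace_matrix_nilpotent_endo:
  fixes f :: "'k::field^'n \<Rightarrow> 'k^'n"
  assumes "Vector_Spaces.linear (*s) (*s) f" and "nilpotent_endo f"
  shows "trace (matrix f) = 0"
proof -
  obtain m where "f^^m = (\<lambda>_. 0)" using assms(2) by (auto simp: nilpotent_endo_def)
  then have "((**) (matrix f) ^^ m) (mat 1) = 0"
    using matrix_funpow[OF assms(1), of m] by (simp add: matrix_def vec_eq_iff)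
  then show ?thesis by (rule trace_nilpotent_matrix)
qed

lemma nilpotent_endo_comp_self:
  assumes "nilpotent_endo f"
  shows "nilpotent_endo (f \<circ> f)"
proof -
  obtain m where m: "f^^m = (\<lambda>_. 0)" using assms by (auto simp: nilpotent_endo_def)
  have "(f \<circ> f)^^m = (f^^2)^^m" by (simp add: numeral_2_eq_2)
  also have "\<dots> = (f^^m)^^2" by (simp add: funpow_mult mult.commute)
  also have "\<dots> = (\<lambda>_. 0)" using m by (simp add: numeral_2_eq_2)
  finally show ?thesis by (auto simp: nilpotent_endo_def)
qed

lemma trace_square_nilpotent_endo:
  fixes f :: "'k::field^'n \<Rightarrow> 'k^'n"
  assumes "Vector_Spaces.linear (*s) (*s) f" and "nilpotent_endo f"
  shows "trace (matrix f ** matrix f) = 0"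
  using trace_matrix_nilpotent_endo[OF Vector_Spaces.linear_compose[OF assms(1) assms(1)]
      nilpotent_endo_comp_self[OF assms(2)]]
  by (simp add: matrix_compose_gen[OF assms(1) assms(1)])

lemma matrix_add_fun: "matrix (\<lambda>z. f z + g z) = matrix f + matrix g"
  by (simp add: matrix_def vec_eq_iff)

lemma matrix_diff_fun: "matrix (\<lambda>z. f z - g z) = matrix f - matrix g"
  by (simp add: matrix_def vec_eq_iff)

lemma trace_matrix_rank_one:
  fixes \<phi> :: "'k::field^'n \<Rightarrow> 'k"
  assumes "Vector_Spaces.linear (*s) (*) \<phi>"
  shows "trace (matrix (\<lambda>z. \<phi> z *s a)) = \<phi> a"
proof -
  interpret \<phi>: Vector_Spaces.linear "(*s)" "(*)" \<phi> by fact
  have "\<phi> a = \<phi> (\<Sum>i\<in>UNIV. a$i *s axis i 1)" by (simp add: basis_expansion)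
  also have "\<dots> = (\<Sum>i\<in>UNIV. a$i * \<phi> (axis i 1))" by (simp add: \<phi>.sum \<phi>.scale)
  also have "\<dots> = trace (matrix (\<lambda>z. \<phi> z *s a))" by (simp add: trace_def matrix_def mult.commute)
  finally show ?thesis ..
qed

lemma matrix_add_rdistrib: "(A + B) ** C = A ** C + B ** (C :: 'a::semiring_1^_^_)"
  by (simp add: matrix_matrix_mult_def vec_eq_iff distrib_right sum.distrib)

lemma trace_mul_polarization:
  fixes A B :: "'k::comm_ring_1^'n^'n"
  shows "trace ((A + B) ** (A + B)) = trace (A ** A) + 2 * trace (A ** B) + trace (B ** B)"
proof -
  have "(A + B) ** (A + B) = A ** A + A ** B + (B ** A + B ** B)"
    by (simp add: matrix_add_ldistrib matrix_add_rdistrib add.assoc)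
  then have "trace ((A + B) ** (A + B)) = trace (A ** A) + trace (A ** B) + (trace (B ** A) + trace (B ** B))"
    by (simp only: trace_add)
  also have "\<dots> = trace (A ** A) + 2 * trace (A ** B) + trace (B ** B)"
    by (simp only: trace_mul_sym[of B A] mult_2 add.assoc)
  finally show ?thesis .
qed

lemma trace_mul_eq_0_in_nilpotent_subspace:
  fixes S :: "('k::field^'n \<Rightarrow> 'k^'n) set"
  assumes "(2::'k) \<noteq> 0" and "endo_subspace S"
    and "\<forall>v\<in>S. Vector_Spaces.linear (*s) (*s) v \<and> nilpotent_endo v"
    and "u \<in> S" and "w \<in> S"
  shows "trace (matrix u ** matrix w) = 0"
proof -
  have square: "trace (matrix v ** matrix v) = 0" if "v \<in> S" for v
    using assms(3) that trace_square_nilpotent_endo by blast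
  have sum: "(\<lambda>z. u z + w z) \<in> S" using assms(2,4,5) by (auto simp: endo_subspace_def)
  have "2 * trace (matrix u ** matrix w) = trace ((matrix u + matrix w) ** (matrix u + matrix w))"
    using square[OF assms(4)] square[OF assms(5)]
    by (simp only: trace_mul_polarization add_0 add_0_right)
  also have "\<dots> = 0"
    by (rule square[OF sum, unfolded matrix_add_fun])
  finally show ?thesis using assms(1) by simp
qed

lemma bilinear_form_add_scale:
  assumes "bilinear_form b"
  shows "b (p + q) z = b p z + b q z" "b (c *s p) z = c * b p z"
    "b z (p + q) = b z p + b z q" "b z (c *s p) = c * b z p"
  using assms by (simp_all add: bilinear_form_def Vector_Spaces.linear_iff)

lemma alternating_form_skew:
  assumes "bilinear_form b" and "alternating_form b"
  shows "b x y = - b y x"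
proof -
  have "b (x + y) (x + y) = b x x + b x y + b y x + b y y"
    using assms(1) by (simp add: bilinear_form_add_scale)
  then show ?thesis using assms(2) by (simp add: alternating_form_def eq_neg_iff_add_eq_0)
qed

lemma b_alternating_skew:
  assumes "bilinear_form b" and "b_alternating b u"
  shows "b x (u y) = - b y (u x)"
proof -
  have "u (x + y) = u x + u y" using assms(2) by (simp add: b_alternating_def Vector_Spaces.linear_iff)
  then have "0 = b (x + y) (u x + u y)" using assms(2) by (metis b_alternating_def)
  also have "\<dots> = b x (u y) + b y (u x)"
    using assms by (simp add: bilinear_form_add_scale b_alternating_def)
  finally show ?thesis by (simp add: eq_neg_iff_add_eq_0)
qed

lemma linear_wedge_b:
  assumes "bilinear_form b"
  shows "Vector_Spaces.linear (*s) (*s) (wedge_b b x y)"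
  using assms unfolding wedge_b_def Vector_Spaces.linear_iff
  by (simp add: vec.vector_space_axioms bilinear_form_add_scale algebra_simps)

lemma trace_matrix_comp_wedge_b:
  assumes "bilinear_form b" and "Vector_Spaces.linear (*s) (*s) u"
  shows "trace (matrix (u \<circ> wedge_b b x y)) = b y (u x) - b x (u y)"
proof -
  interpret u: Vector_Spaces.linear "(*s)" "(*s)" u by fact
  have "u \<circ> wedge_b b x y = (\<lambda>z. b y z *s u x - b x z *s u y)"
    by (simp add: fun_eq_iff wedge_b_def u.diff u.scale)
  moreover have "Vector_Spaces.linear (*s) (*) (b p)" for p
    using assms(1) by (simp add: bilinear_form_def)
  ultimately show ?thesis
    by (simp add: matrix_diff_fun trace_sub trace_matrix_rank_one)
qed

theorem mainTheorem12:
  fixes b :: "'k::field^'n \<Rightarrow> 'k^'n \<Rightarrow> 'k"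
    and S :: "('k^'n \<Rightarrow> 'k^'n) set"
    and x y :: "'k^'n" and u :: "'k^'n \<Rightarrow> 'k^'n"
  assumes char: "(2::'k) \<noteq> 0"
    and bil: "bilinear_form b"
    and symalt: "symmetric_form b \<or> alternating_form b"
    and nondeg: "nondegenerate_form b"
    and sub: "endo_subspace S"
    and SA: "S \<subseteq> A_b b"
    and nil: "\<forall>v\<in>S. nilpotent_endo v"
    and x0: "x \<noteq> 0"
    and uS: "u \<in> S"
    and wS: "wedge_b b x y \<in> S"
  shows "b (u x) y = 0"
proof -
  have alt_u: "b_alternating b u" using SA uS by (auto simp: A_b_def)
  then have lin_u: "Vector_Spaces.linear (*s) (*s) u" by (simp add: b_alternating_def)
  have nilpotent_S: "\<forall>v\<in>S. Vector_Spaces.linear (*s) (*s) v \<and> nilpotent_endo v"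
    using SA nil by (auto simp: A_b_def b_alternating_def)
  have "b y (u x) - b x (u y) = trace (matrix (u \<circ> wedge_b b x y))"
    by (rule trace_matrix_comp_wedge_b[OF bil lin_u, symmetric])
  also have "\<dots> = trace (matrix u ** matrix (wedge_b b x y))"
    by (simp only: matrix_compose_gen[OF linear_wedge_b[OF bil] lin_u])
  also have "\<dots> = 0"
    by (rule trace_mul_eq_0_in_nilpotent_subspace[OF char sub nilpotent_S uS wS])
  finally have "b y (u x) - b x (u y) = 0" .
  then have "b y (u x) + b y (u x) = 0"
    by (simp only: b_alternating_skew[OF bil alt_u, of x y] diff_minus_eq_add)
  then have "b y (u x) = 0" using char by (simp only: mult_2[symmetric] mult_eq_0_iff) simp
  with symalt show ?thesis
    using alternating_form_skew[OF bil, of "u x" y] by (auto simp: symmetric_form_def)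
qed

end
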